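(* Let $n \ge 2$ be an integer. Then the set $\mathbf{FS}_n := \mathbf{DI}_n \setminus (\mathbf{Bad}_n \cup \mathbf{Sing}_n)$ has continuum many points.
   Context: For $x\in\mathbb{R}$ let $\langle x\rangle := \min\{|x-m| : m\in\mathbb{Z}\}$ and for $\mathbf{x}=(x_1,\dots,x_n)\in\mathbb{R}^n$ let $\langle \mathbf{x}\rangle := \max_{1\le i\le n}\langle x_i\rangle$. For $\varepsilon\in(0,1)$ and $N\in\mathbb{N}$ consider the condition $(\star)$ on $q\in\mathbb{Z}$: $\langle q\mathbf{x}\rangle < \varepsilon N^{-1/n}$ and $1\le q\le N$. $\mathbf{DI}_n$ (Dirichlet improvable points) is the set of $\mathbf{x}\in\mathbb{R}^n$ for which there exists $\varepsilon\in(0,1)$ such that for all sufficiently large $N>N_0(\mathbf{x},\varepsilon)$ there exists $q\in\mathbb{Z}$ satisfying $(\star)$. $\mathbf{Sing}_n$ (singular points) is the set of $\mathbf{x}\in\mathbb{R}^n$ such that for every $\varepsilon\in(0,1)$, for all sufficiently large $N>N_0(\mathbf{x},\varepsilon)$ there exists $q\in\mathbb{Z}$ satisfying $(\star)$. $\mathbf{Bad}_n$ (badly approximable points) is the set of $\mathbf{x}\in\mathbb{R}^n$ for which there exists $\varepsilon=\varepsilon(\mathbf{x})\in(0,1)$ with $\langle q\mathbf{x}\rangle > \varepsilon q^{-1/n}$ for all $q\in\mathbb{N}$. *)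

theory Defs
  imports "HOL-Analysis.Analysis" "HOL-Library.Equipollence"
begin

(* The infimum is attained, see int_dist_is_min. *)
definition int_dist :: "real \<Rightarrow> real" where
  "int_dist x = (INF m::int. \<bar>x - of_int m\<bar>)"

lemma int_dist_eq_round: "int_dist x = \<bar>x - of_int (round x)\<bar>"
  unfolding int_dist_def
proof (rule cInf_eq_minimum)
  show "\<bar>x - of_int (round x)\<bar> \<in> range (\<lambda>m::int. \<bar>x - of_int m\<bar>)"
    by blast
next
  fix y assume "y \<in> range (\<lambda>m::int. \<bar>x - of_int m\<bar>)"
  then show "\<bar>x - of_int (round x)\<bar> \<le> y"
    using round_diff_minimal[of x] by auto
qed

lemma int_dist_is_min:
  "int_dist x \<in> {\<bar>x - of_int m\<bar> | m::int. True}"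
  "int_dist x \<le> \<bar>x - of_int m\<bar>"
  using round_diff_minimal[of x m] by (auto simp: int_dist_eq_round)

definition int_dist_vec :: "real ^ 'n \<Rightarrow> real" where
  "int_dist_vec x = Max (range (\<lambda>i. int_dist (x $ i)))"

definition dirichlet_cond :: "real ^ 'n \<Rightarrow> real \<Rightarrow> nat \<Rightarrow> int \<Rightarrow> bool" where
  "dirichlet_cond x \<epsilon> N q \<longleftrightarrow>
     int_dist_vec (of_int q *\<^sub>R x) < \<epsilon> * real N powr (- 1 / real CARD('n)) \<and>
     1 \<le> q \<and> q \<le> int N"

definition DI :: "(real ^ 'n) set" where
  "DI = {x. \<exists>\<epsilon>\<in>{0<..<1}. \<exists>N\<^sub>0. \<forall>N>N\<^sub>0. \<exists>q. dirichlet_cond x \<epsilon> N q}"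

definition Sing :: "(real ^ 'n) set" where
  "Sing = {x. \<forall>\<epsilon>\<in>{0<..<1}. \<exists>N\<^sub>0. \<forall>N>N\<^sub>0. \<exists>q. dirichlet_cond x \<epsilon> N q}"

(* Here q ranges over the positive integers; q = 0 would make the set empty. *)
definition Bad :: "(real ^ 'n) set" where
  "Bad = {x. \<exists>\<epsilon>\<in>{0<..<1}. \<forall>q::nat. 1 \<le> q \<longrightarrow>
     int_dist_vec (real q *\<^sub>R x) > \<epsilon> * real q powr (- 1 / real CARD('n))}"

definition FS :: "(real ^ 'n) set" where
  "FS = DI - (Bad \<union> Sing)"

end

theory Submission
  imports Defs
begin

text \<open>
  A point \<open>x\<close> is described by its successive good rational approximations, encoded as integer
  vectors \<open>v\<^sub>k = (p\<^sub>k, q\<^sub>k)\<close> with errors \<open>\<xi>\<^sub>k = q\<^sub>k x - p\<^sub>k\<close>. Up to constants, Dirichlet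
  improvability asks that \<open>q\<^sub>k\<^sub>+\<^sub>1 \<bar>\<xi>\<^sub>k\<bar>\<^sup>n\<close> is eventually small, singularity that it tends to \<open>0\<close>,
  and bad approximability that \<open>q\<^sub>k \<bar>\<xi>\<^sub>k\<bar>\<^sup>n\<close> is bounded below. So it suffices to find a sequence in
  which \<open>q\<^sub>k\<^sub>+\<^sub>1 \<bar>\<xi>\<^sub>k\<bar>\<^sup>n\<close> is always below an explicit small constant and infinitely often above a
  positive one, while \<open>q\<^sub>k\<^sub>+\<^sub>1 / q\<^sub>k\<close> is unbounded.

  The vectors start with the standard basis of \<open>\<int>\<^sup>n\<^sup>+\<^sup>1\<close> and continue by
  \<open>v\<^sub>t\<^sub>+\<^sub>n\<^sub>+\<^sub>1 = a\<^sub>t v\<^sub>t\<^sub>+\<^sub>n + v\<^sub>t\<close>, so that any \<open>n + 1\<close> consecutive ones form a basis of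
  \<open>\<int>\<^sup>n\<^sup>+\<^sup>1\<close>. With rapidly growing multipliers \<open>a\<^sub>t\<close>, a point that keeps all errors small satisfies
  \<open>\<xi>\<^sub>t\<^sub>+\<^sub>n \<approx> - \<xi>\<^sub>t / a\<^sub>t\<close>: the errors cycle through the coordinate directions, and their lengths
  are close to the prescribed numbers \<open>s\<^sub>k\<close> with \<open>s\<^sub>t\<^sub>+\<^sub>n = s\<^sub>t / a\<^sub>t\<close>
  (\<open>solution_drift\<close>, \<open>followed_drift\<close>). At the same time \<open>q\<^sub>t\<^sub>+\<^sub>n\<close> is the inverse of
  \<open>s\<^sub>t \<cdots> s\<^sub>t\<^sub>+\<^sub>n\<^sub>-\<^sub>1\<close> up to a factor of \<open>2\<close> (\<open>q_window_product_bounds\<close>). Hence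
  \<open>q\<^sub>k\<^sub>+\<^sub>1 \<bar>\<xi>\<^sub>k\<bar>\<^sup>n\<close> is comparable to the product of the ratios \<open>s\<^sub>k / s\<^sub>k\<^sub>-\<^sub>j\<close> for \<open>j < n\<close>.
  Since \<open>n \<ge> 2\<close>, at least one of these ratios is not the trivial one, and making consecutive
  \<open>s\<^sub>k\<close> differ by a large constant factor makes the product small (\<open>next_denominator_bound\<close>).
  Making them differ by at most a bounded factor along infinitely many windows of length \<open>n\<close>
  keeps the product away from \<open>0\<close>; that no other denominator does better there follows from the
  basis property and the almost orthogonal directions (\<open>window_lower_bound\<close>).

  Finally there is a free binary choice in each block of \<open>n\<close> steps, and the sequence of lengths
  can be read off the point (\<open>followed_by_inj\<close>), which gives an injection of the sets of natural
  numbers into the set in question.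
\<close>

section \<open>Integer vectors generated by a recurrence of order n + 1\<close>

text \<open>
  \<open>coord e n j k\<close> is the \<open>j\<close>-th coordinate of \<open>v\<^sub>k\<close>; the coordinate with index \<open>n\<close> is the
  denominator and those below \<open>n\<close> are the numerators. The multiplier is the power of two that
  turns the length \<open>(1/2)^(e (t + n))\<close> into \<open>(1/2)^(e t)\<close>.
\<close>
fun coord :: "(nat \<Rightarrow> nat) \<Rightarrow> nat \<Rightarrow> nat \<Rightarrow> nat \<Rightarrow> int" where
  "coord e n j k =
     (if k \<le> n then of_bool (j = k)
      else 2 ^ (e (k - 1) - e (k - 1 - n)) * coord e n j (k - 1) + coord e n j (k - 1 - n))"

declare coord.simps [simp del]

lemma coord_initial: "k \<le> n \<Longrightarrow> coord e n j k = of_bool (j = k)"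
  by (simp add: coord.simps)

lemma coord_rec:
  "coord e n j (Suc (t + n)) = 2 ^ (e (t + n) - e t) * coord e n j (t + n) + coord e n j t"
  by (subst coord.simps) simp

lemma coord_cong:
  assumes "\<And>i. i < k \<Longrightarrow> e i = e' i"
  shows "coord e n j k = coord e' n j k"
  using assms
proof (induction k rule: less_induct)
  case (less k)
  show ?case
  proof (cases "k \<le> n")
    case True
    then show ?thesis by (simp add: coord_initial)
  next
    case False
    then obtain t where k: "k = Suc (t + n)"
      by (metis add.commute less_imp_Suc_add not_le)
    have "coord e n j (t + n) = coord e' n j (t + n)" "coord e n j t = coord e' n j t"
      by (rule less.IH; use k less.prems in simp)+
    moreover have "e (t + n) = e' (t + n)" "e t = e' t"
      using k less.prems by auto
    ultimately show ?thesis by (simp add: k coord_rec)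
  qed
qed

text \<open>
  The recurrence can be solved for its oldest vector with integer coefficients, so the integer span
  of a window does not change when the window moves, and the first window is the standard basis.
\<close>
lemma coord_window_spans:
  assumes "0 < n"
  shows "\<exists>b :: nat \<Rightarrow> int. \<forall>j\<le>n. w j = (\<Sum>l\<le>n. b l * coord e n j (t + l))"
proof (induction t)
  case 0
  have "w j = (\<Sum>l\<le>n. w l * coord e n j (0 + l))" if "j \<le> n" for j
  proof -
    have "(\<Sum>l\<le>n. w l * coord e n j (0 + l)) = (\<Sum>l\<le>n. if l = j then w l else 0)"
      by (rule sum.cong) (auto simp: coord_initial)
    also have "\<dots> = w j" using that by simp
    finally show ?thesis ..
  qed
  then show ?case by blast
next
  case (Suc t)
  then obtain b :: "nat \<Rightarrow> int"
    where b: "\<And>j. j \<le> n \<Longrightarrow> w j = (\<Sum>l\<le>n. b l * coord e n j (t + l))" by blast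
  define \<alpha> :: int where "\<alpha> = 2 ^ (e (t + n) - e t)"
  obtain n' where Suc: "n = Suc n'" using \<open>0 < n\<close> by (cases n) auto
    define b' where "b' l = (if l = n then b 0
        else if l = n' then b (Suc l) - \<alpha> * b 0 else b (Suc l))" for l
    have "w j = (\<Sum>l\<le>n. b' l * coord e n j (Suc t + l))" if j: "j \<le> n" for j
    proof -
      let ?v = "coord e n j"
      have rec: "?v (Suc (t + n)) = \<alpha> * ?v (t + n) + ?v t"
        by (simp add: coord_rec \<alpha>_def)
      have "w j = (\<Sum>l\<le>Suc n'. b l * ?v (t + l))"
        using b[OF j] Suc by simp
      also have "\<dots> = b 0 * ?v t + (\<Sum>l\<le>n'. b (Suc l) * ?v (t + Suc l))"
        by (subst sum.atMost_Suc_shift) simp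
      also have "(\<Sum>l\<le>n'. b (Suc l) * ?v (t + Suc l))
          = (\<Sum>l<n'. b (Suc l) * ?v (t + Suc l)) + b n * ?v (t + n)"
        by (simp add: lessThan_Suc_atMost[symmetric] Suc)
      also have "(\<Sum>l<n'. b (Suc l) * ?v (t + Suc l)) = (\<Sum>l<n'. b' l * ?v (Suc t + l))"
        by (rule sum.cong) (auto simp: b'_def Suc)
      finally have "w j = (\<Sum>l<n'. b' l * ?v (Suc t + l))
          + (b n - \<alpha> * b 0) * ?v (t + n) + b 0 * ?v (Suc (t + n))"
        unfolding rec by (simp add: algebra_simps)
      also have "\<dots> = (\<Sum>l\<le>n. b' l * ?v (Suc t + l))"
        by (simp add: Suc b'_def lessThan_Suc_atMost[symmetric])
      finally show ?thesis .
    qed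
    then show ?case by blast
qed

text \<open>
  A sequence that nearly repeats up to sign with period \<open>n\<close> stays near its initial values, because
  the deviations are summable. The induction carries the factor \<open>1 - (1/2)^k\<close>, which leaves room
  for the geometric tail.
\<close>
lemma periodic_drift:
  fixes u :: "nat \<Rightarrow> real"
  assumes "0 < n" "0 \<le> M"
    and step: "\<And>t. t + n < K \<Longrightarrow> \<bar>\<bar>u (t + n)\<bar> - \<bar>u t\<bar>\<bar> \<le> M * (1 / 2) ^ (t + 2 * n + 1)"
    and "k < K"
  shows "\<bar>\<bar>u k\<bar> - \<bar>u (k mod n)\<bar>\<bar> \<le> M * (1 / 2) ^ Suc n"
proof -
  have "\<bar>\<bar>u k\<bar> - \<bar>u (k mod n)\<bar>\<bar> \<le> M * (1 / 2) ^ Suc n * (1 - (1 / 2) ^ k)"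
    using \<open>k < K\<close>
  proof (induction k rule: less_induct)
    case (less k)
    show ?case
    proof (cases "k < n")
      case True
      then show ?thesis using \<open>0 \<le> M\<close> by (simp add: power_le_one)
    next
      case False
      then obtain t where k: "k = t + n" by (metis add.commute le_Suc_ex not_less)
      have IH: "\<bar>\<bar>u t\<bar> - \<bar>u (t mod n)\<bar>\<bar> \<le> M * (1 / 2) ^ Suc n * (1 - (1 / 2) ^ t)"
        using less k \<open>0 < n\<close> by simp
      have "(1 / 2 :: real) ^ n \<le> (1 / 2) ^ 1"
        using \<open>0 < n\<close> by (intro power_decreasing) auto
      then have "(1 / 2 :: real) ^ t * (1 / 2) ^ n \<le> (1 / 2) ^ t * (1 / 2)"
        by (intro mult_left_mono) auto
      then have "(1 / 2 :: real) ^ k + (1 / 2) ^ k \<le> (1 / 2) ^ t"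
        by (simp add: k power_add)
      then have "M * (1 / 2) ^ Suc n * ((1 - (1 / 2) ^ t) + (1 / 2) ^ k)
          \<le> M * (1 / 2) ^ Suc n * (1 - (1 / 2) ^ k)"
        using \<open>0 \<le> M\<close> by (intro mult_left_mono) auto
      moreover have "M * (1 / 2) ^ (t + 2 * n + 1) = M * (1 / 2) ^ Suc n * (1 / 2) ^ k"
        by (simp add: k power_add mult_2)
      moreover have "\<bar>\<bar>u k\<bar> - \<bar>u (k mod n)\<bar>\<bar> \<le> \<bar>\<bar>u k\<bar> - \<bar>u t\<bar>\<bar> + \<bar>\<bar>u t\<bar> - \<bar>u (t mod n)\<bar>\<bar>"
        unfolding k mod_add_self2 by linarith
      moreover have "\<bar>\<bar>u k\<bar> - \<bar>u t\<bar>\<bar> \<le> M * (1 / 2) ^ (t + 2 * n + 1)"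
        using step[of t] less.prems by (simp add: k)
      ultimately show ?thesis
        using IH by (simp only: distrib_left)
    qed
  qed
  also have "\<dots> \<le> M * (1 / 2) ^ Suc n * 1"
    using \<open>0 \<le> M\<close> by (intro mult_left_mono) auto
  finally show ?thesis by simp
qed

section \<open>Exponents\<close>

definition scale :: "(nat \<Rightarrow> nat) \<Rightarrow> nat \<Rightarrow> real" where
  "scale e k = (1 / 2) ^ e k"

text \<open>
  The prescribed lengths are powers of \<open>1/2\<close>. The condition \<open>gap\<close> makes consecutive lengths differ
  by a factor that beats the constants \<open>2\<^sup>n\<close> lost in the estimates, and \<open>growth\<close> makes the inverse
  multipliers summable.
\<close>
locale exponents =
  fixes n :: nat and e :: "nat \<Rightarrow> nat"
  assumes n2: "2 \<le> n"
    and start: "k < n \<Longrightarrow> e k = 0"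
    and gap: "n \<le> Suc k \<Longrightarrow> e k + n + 4 \<le> e (Suc k)"
    and growth: "e t + t + 2 * n + 1 \<le> e (t + n)"
begin

abbreviation s where "s \<equiv> scale e"
abbreviation q where "q \<equiv> coord e n n"

lemma s_pos [simp]: "0 < s k" "0 \<le> s k"
  by (simp_all add: scale_def)

lemma s_start: "k < n \<Longrightarrow> s k = 1"
  by (simp add: scale_def start)

lemma s_growth: "s (t + n) \<le> s t * (1 / 2) ^ (t + 2 * n + 1)"
  using power_decreasing[OF growth[of t], of "1/2 :: real"]
  by (simp add: scale_def power_add)

lemma s_gap: "n \<le> Suc k \<Longrightarrow> s (Suc k) \<le> s k * (1 / 2) ^ (n + 4)"
  using power_decreasing[OF gap[of k], of "1/2 :: real"]
  by (simp add: scale_def power_add)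

lemma e_Suc: "e k \<le> e (Suc k)"
  using gap[of k] start[of k] by (cases "n \<le> Suc k") auto

lemma e_mono: "k \<le> l \<Longrightarrow> e k \<le> e l"
  by (rule lift_Suc_mono_le[of e]) (auto intro: e_Suc)

lemma s_anti: "k \<le> l \<Longrightarrow> s l \<le> s k"
  unfolding scale_def by (intro power_decreasing e_mono) auto

lemma multiplier: "2 ^ (e (t + n) - e t) * s (t + n) = s t"
proof -
  have "e (t + n) = (e (t + n) - e t) + e t" using growth[of t] by simp
  then have "s (t + n) = (1 / 2) ^ (e (t + n) - e t) * s t"
    unfolding scale_def by (metis power_add)
  then show ?thesis by (simp add: power_one_over)
qed

lemma multiplier_ge: "(2 :: 'a :: linordered_semidom) ^ (t + 2 * n + 1) \<le> 2 ^ (e (t + n) - e t)"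
  using growth[of t] by (intro power_increasing) auto

lemma coord_nonneg: "0 \<le> coord e n j k"
proof (induction k rule: less_induct)
  case (less k)
  then show ?case by (subst coord.simps) simp
qed

lemma q_growth: "2 ^ (t + 2 * n + 1) * q (t + n) \<le> q (Suc (t + n))"
proof -
  have "2 ^ (t + 2 * n + 1) * q (t + n) \<le> 2 ^ (e (t + n) - e t) * q (t + n)"
    by (intro mult_right_mono multiplier_ge coord_nonneg)
  then show ?thesis using coord_nonneg[of n t] by (simp add: coord_rec)
qed

lemma q_Suc: "q k \<le> q (Suc k)"
proof (cases "n \<le> k")
  case True
  then obtain t where k: "k = t + n" by (metis add.commute le_Suc_ex)
  have "1 * q (t + n) \<le> 2 ^ (t + 2 * n + 1) * q (t + n)"
    by (intro mult_right_mono coord_nonneg one_le_power) simp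
  then show ?thesis using q_growth[of t] by (simp add: k)
qed (simp add: coord_initial)

lemma q_mono: "k \<le> l \<Longrightarrow> q k \<le> q l"
  by (rule lift_Suc_mono_le[of q]) (auto intro: q_Suc)

lemma q_lower: "int t + 1 \<le> q (t + n)"
proof (induction t)
  case 0
  then show ?case by (simp add: coord_initial)
next
  case (Suc t)
  have "2 ^ 1 * q (t + n) \<le> 2 ^ (t + 2 * n + 1) * q (t + n)"
    by (intro mult_right_mono coord_nonneg power_increasing) auto
  then have "2 * q (t + n) \<le> q (Suc (t + n))"
    using q_growth[of t] unfolding power_one_right by (rule order_trans)
  then show ?case using Suc by simp
qed

text \<open>
  One step of the recurrence multiplies the denominator by about the multiplier and replaces
  \<open>s t\<close> by \<open>s (t + n)\<close> in the product, which divides it by exactly the multiplier. The relative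
  error of a step is at most the inverse multiplier.
\<close>
lemma q_window_product_bounds:
  "1 \<le> q (t + n) * prod s {t..<t + n}"
  "q (t + n) * prod s {t..<t + n} \<le> 2 - (1 / 2) ^ t"
proof (induction t)
  case 0
  have "prod s {0..<0 + n} = 1" by (rule prod.neutral) (auto simp: s_start)
  { case 1 then show ?case using \<open>prod s {0..<0 + n} = 1\<close> by (simp add: coord_initial) }
  { case 2 then show ?case using \<open>prod s {0..<0 + n} = 1\<close> by (simp add: coord_initial) }
next
  case (Suc t)
  let ?P = "q (t + n) * prod s {t..<t + n}"
  let ?R = "prod s {Suc t..<t + n}"
  have R: "0 \<le> ?R" by (simp add: prod_nonneg)
  have n0: "0 < n" using n2 by simp
  have left: "prod s {t..<t + n} = s t * ?R"
    using n0 by (simp add: prod.atLeast_Suc_lessThan)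
  have right: "prod s {Suc t..<Suc t + n} = ?R * s (t + n)"
    using n0 by (simp add: prod.atLeastLessThan_Suc)
  have "q (Suc t + n) * prod s {Suc t..<Suc t + n}
      = (2 ^ (e (t + n) - e t) * q (t + n) + q t) * (?R * s (t + n))"
    using coord_rec[of e n n t] right by simp
  also have "\<dots> = q (t + n) * ?R * (2 ^ (e (t + n) - e t) * s (t + n)) + q t * ?R * s (t + n)"
    by (simp add: algebra_simps)
  finally have eq: "q (Suc t + n) * prod s {Suc t..<Suc t + n} = ?P + q t * ?R * s (t + n)"
    by (simp only: multiplier left) (simp add: algebra_simps)
  have "0 \<le> q t * ?R * s (t + n)"
    using R coord_nonneg[of n t] by simp
  { case 1 then show ?case using Suc(1) eq \<open>0 \<le> q t * ?R * s (t + n)\<close> by linarith }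
  { case 2
    have "q t * ?R * s (t + n) \<le> q (t + n) * ?R * (s t * (1 / 2) ^ (t + 2 * n + 1))"
      using q_mono[of t "t + n"] coord_nonneg[of n t] coord_nonneg[of n "t + n"] R
      by (intro mult_mono s_growth mult_nonneg_nonneg) auto
    also have "\<dots> = ?P * (1 / 2) ^ (t + 2 * n + 1)" by (simp add: left)
    also have "\<dots> \<le> 2 * (1 / 2) ^ (t + 2 * n + 1)"
      using Suc(2) by (intro mult_right_mono) (auto intro: order_trans)
    also have "\<dots> \<le> 2 * (1 / 2) ^ (t + 2)"
      using n2 by (intro mult_left_mono power_decreasing) auto
    also have "\<dots> = (1 / 2) ^ t * (1 / 2)" by (simp add: power_add power2_eq_square)
    finally show ?case using Suc(2) eq by (simp del: prod.op_ivl_Suc) }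
qed

text \<open>
  After division by the lengths the recurrence reads
  \<open>u (t + n) + u t = (s (t + n + 1) / s t) * u (t + n + 1)\<close>, where the right-hand side is tiny as
  soon as \<open>u\<close> is bounded. So a solution which is \<open>O(s)\<close> has absolute values that nearly repeat with
  period \<open>n\<close>.
\<close>
lemma solution_drift:
  assumes rec: "\<And>t. t + n < K \<Longrightarrow>
      z (Suc (t + n)) = 2 ^ (e (t + n) - e t) * z (t + n) + (z t :: real)"
    and bound: "\<And>k. k \<le> K \<Longrightarrow> \<bar>z k\<bar> \<le> M * s k"
    and "k < K"
  shows "\<bar>\<bar>z k\<bar> - \<bar>z (k mod n)\<bar> * s k\<bar> \<le> M * (1 / 2) ^ Suc n * s k"
proof -
  define u where "u k = z k / s k" for k
  have n0: "0 < n" using n2 by simp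
  have "0 \<le> M * s 0" using bound[of 0] by (meson abs_ge_zero order_trans le0)
  then have M: "0 \<le> M" using s_pos(1)[of 0] by (simp add: zero_le_mult_iff)
  have z: "z k = s k * u k" for k
    by (simp add: u_def less_imp_neq[OF s_pos(1), symmetric])
  have u_le: "\<bar>u k\<bar> \<le> M" if "k \<le> K" for k
    using bound[OF that] by (simp add: z abs_mult mult.commute)
  have step: "\<bar>\<bar>u (t + n)\<bar> - \<bar>u t\<bar>\<bar> \<le> M * (1 / 2) ^ (t + 2 * n + 1)" if "t + n < K" for t
  proof -
    have "s (Suc (t + n)) * u (Suc (t + n))
        = (2 ^ (e (t + n) - e t) * s (t + n)) * u (t + n) + s t * u t"
      using rec[OF that] by (simp add: z)
    then have "s (Suc (t + n)) * u (Suc (t + n)) = s t * (u (t + n) + u t)"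
      by (simp add: multiplier distrib_left)
    then have "s t * \<bar>u (t + n) + u t\<bar> = s (Suc (t + n)) * \<bar>u (Suc (t + n))\<bar>"
      by (metis abs_mult abs_of_pos s_pos(1))
    also have "\<dots> \<le> (s t * (1 / 2) ^ (t + 2 * n + 1)) * M"
      using that by (intro mult_mono u_le order_trans[OF s_anti s_growth]) auto
    finally have "s t * \<bar>u (t + n) + u t\<bar> \<le> s t * (M * (1 / 2) ^ (t + 2 * n + 1))"
      by (simp add: mult_ac)
    then have "\<bar>u (t + n) + u t\<bar> \<le> M * (1 / 2) ^ (t + 2 * n + 1)"
      using s_pos(1)[of t] by (simp only: mult_le_cancel_left_pos)
    then show ?thesis by linarith
  qed
  have "\<bar>\<bar>u k\<bar> - \<bar>u (k mod n)\<bar>\<bar> \<le> M * (1 / 2) ^ Suc n"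
    by (rule periodic_drift[OF n0 M step \<open>k < K\<close>])
  then have "s k * \<bar>\<bar>u k\<bar> - \<bar>u (k mod n)\<bar>\<bar> \<le> s k * (M * (1 / 2) ^ Suc n)"
    by (intro mult_left_mono) auto
  moreover have "s k * \<bar>\<bar>u k\<bar> - \<bar>u (k mod n)\<bar>\<bar> = \<bar>s k * \<bar>u k\<bar> - s k * \<bar>u (k mod n)\<bar>\<bar>"
    by (simp only: abs_mult right_diff_distrib[symmetric] abs_of_pos[OF s_pos(1)])
  moreover have "s k * \<bar>u k\<bar> = \<bar>z k\<bar>" "s k * \<bar>u (k mod n)\<bar> = \<bar>z (k mod n)\<bar> * s k"
    using n0 by (simp_all add: z abs_mult s_start)
  moreover have "s k * (M * (1 / 2) ^ Suc n) = M * (1 / 2) ^ Suc n * s k"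
    by (rule mult.commute)
  ultimately show ?thesis by (simp only:)
qed

text \<open>
  For a finite range the boundedness needed in the preceding lemma is automatic, with some constant
  \<open>M\<close>. Inserting the drift estimate at an index where \<open>M\<close> is attained gives \<open>M \<le> 1 + M / 2\<close>, so
  the constant \<open>2\<close> works for every length of the range.
\<close>
lemma terminating_solution_bound:
  assumes rec: "\<And>t. t + n < K \<Longrightarrow>
      z (Suc (t + n)) = 2 ^ (e (t + n) - e t) * z (t + n) + (z t :: real)"
    and last: "z K = 0"
    and init: "\<And>k. k < n \<Longrightarrow> \<bar>z k\<bar> \<le> 1"
    and "k \<le> K"
  shows "\<bar>z k\<bar> \<le> 2 * s k"
proof -
  define M where "M = Max ((\<lambda>k. \<bar>z k\<bar> / s k) ` {..K})"
  have n0: "0 < n" using n2 by simp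
  have bound: "\<bar>z k\<bar> \<le> M * s k" if "k \<le> K" for k
  proof -
    have "\<bar>z k\<bar> / s k \<le> M" unfolding M_def using that by (intro Max_ge) auto
    then show ?thesis by (simp add: pos_divide_le_eq)
  qed
  have "M \<in> (\<lambda>k. \<bar>z k\<bar> / s k) ` {..K}"
    unfolding M_def by (rule Max_in) auto
  then obtain k0 where k0: "k0 \<le> K" "M = \<bar>z k0\<bar> / s k0" by auto
  then have M0: "0 \<le> M" by simp
  have "M \<le> 2"
  proof (cases "k0 = K")
    case True
    then show ?thesis using k0 last by simp
  next
    case False
    then have "k0 < K" using k0 by simp
    have "\<bar>\<bar>z k0\<bar> - \<bar>z (k0 mod n)\<bar> * s k0\<bar> \<le> M * (1 / 2) ^ Suc n * s k0"
      using rec bound \<open>k0 < K\<close> by (rule solution_drift)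
    moreover have "\<bar>z k0\<bar> = M * s k0" using k0 less_imp_neq[OF s_pos(1)[of k0]] by simp
    moreover have "\<bar>z (k0 mod n)\<bar> * s k0 \<le> 1 * s k0"
      using n0 by (intro mult_right_mono init) auto
    ultimately have "M * s k0 \<le> 1 * s k0 + M * (1 / 2) ^ Suc n * s k0"
      by linarith
    then have "M * s k0 \<le> (1 + M * (1 / 2) ^ Suc n) * s k0"
      by (simp only: distrib_right)
    then have "M \<le> 1 + M * (1 / 2) ^ Suc n"
      using s_pos(1)[of k0] by (simp only: mult_le_cancel_right_pos)
    also have "\<dots> \<le> 1 + M * (1 / 2) ^ 1"
      using M0 by (intro add_left_mono mult_left_mono power_decreasing) auto
    finally show ?thesis by simp
  qed
  then have "M * s k \<le> 2 * s k" by (intro mult_right_mono) auto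
  then show ?thesis using bound[OF \<open>k \<le> K\<close>] by linarith
qed

text \<open>
  For an arbitrary \<open>x\<close> the errors solve the recurrence but grow like the denominators; requiring them
  to be of the order of the prescribed lengths singles out the point that the rational points
  \<open>p\<^sub>k / q\<^sub>k\<close> converge to.
\<close>
definition followed_by :: "(nat \<Rightarrow> real) \<Rightarrow> bool" where
  "followed_by x \<longleftrightarrow> (\<forall>c<n. \<forall>k. \<bar>real_of_int (q k) * x c - coord e n c k\<bar> \<le> 2 * s k)"

text \<open>
  For the rational point \<open>p\<^sub>K / q\<^sub>K\<close> the error vanishes at index \<open>K\<close>, so it obeys the bounds up to
  \<open>K\<close>. A limit point of these rational points obeys all of them.
\<close>
lemma followed_point_exists: "\<exists>x. followed_by x"
proof -
  have "\<exists>y :: real. \<forall>k. \<bar>q k * y - coord e n c k\<bar> \<le> 2 * s k" if "c < n" for c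
  proof -
    define f :: "nat \<Rightarrow> real" where "f K = coord e n c (K + n) / q (K + n)" for K
    have q0: "0 < q (K + n)" for K using q_lower[of K] by simp
    have fK: "\<bar>q k * f K - coord e n c k\<bar> \<le> 2 * s k" if "k \<le> K + n" for k K
    proof -
      define z where "z k = q k * f K - coord e n c k" for k
      have "\<bar>z k\<bar> \<le> 2 * s k"
      proof (rule terminating_solution_bound[where K = "K + n"])
        show "z (Suc (t + n)) = 2 ^ (e (t + n) - e t) * z (t + n) + z t" for t
          unfolding z_def coord_rec by (simp add: algebra_simps)
        show "z (K + n) = 0" using q0[of K] by (simp add: z_def f_def)
        show "\<bar>z k\<bar> \<le> 1" if "k < n" for k
          using that by (simp add: z_def coord_initial)
      qed (fact that)
      then show ?thesis by (simp add: z_def)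
    qed
    have "f K \<in> {-2..2}" for K
    proof -
      have "\<bar>f K\<bar> \<le> 2 * s n" using fK[of n K] \<open>c < n\<close> by (simp add: coord_initial)
      also have "\<dots> \<le> 2 * 1" by (intro mult_left_mono) (auto simp: scale_def power_le_one)
      finally show ?thesis by (simp add: abs_le_iff)
    qed
    then obtain y r where r: "strict_mono r" and lim: "(f \<circ> r) \<longlonglongrightarrow> y"
      using compact_imp_seq_compact[OF compact_Icc, of "-2 :: real" 2]
      unfolding seq_compact_def by blast
    have "\<bar>q k * y - coord e n c k\<bar> \<le> 2 * s k" for k
    proof (rule tendsto_upperbound)
      show "(\<lambda>K. \<bar>q k * (f \<circ> r) K - coord e n c k\<bar>) \<longlonglongrightarrow> \<bar>q k * y - coord e n c k\<bar>"
        by (intro tendsto_intros lim)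
      show "\<forall>\<^sub>F K in sequentially. \<bar>q k * (f \<circ> r) K - coord e n c k\<bar> \<le> 2 * s k"
      proof (rule eventually_sequentiallyI[of k])
        fix K assume "k \<le> K"
        then have "k \<le> r K + n" using seq_suble[OF r, of K] by simp
        then show "\<bar>q k * (f \<circ> r) K - coord e n c k\<bar> \<le> 2 * s k" by (simp add: fK)
      qed
    qed simp
    then show ?thesis by blast
  qed
  then show ?thesis unfolding followed_by_def by metis
qed

text \<open>
  For \<open>k < n\<close> the error is minus the unit vector with index \<open>k\<close>. By the drift estimate the error
  of any index \<open>k\<close> therefore points almost along the coordinate axis \<open>k mod n\<close> and has length close
  to \<open>s k\<close>.
\<close>
lemma followed_drift:
  assumes "followed_by x" "c < n"
  shows "\<bar>\<bar>real_of_int (q k) * x c - coord e n c k\<bar> - of_bool (c = k mod n) * s k\<bar> \<le> (1 / 2) ^ n * s k"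
proof -
  define z where "z k = real_of_int (q k) * x c - coord e n c k" for k
  have n0: "0 < n" using n2 by simp
  have "\<bar>\<bar>z k\<bar> - \<bar>z (k mod n)\<bar> * s k\<bar> \<le> 2 * (1 / 2) ^ Suc n * s k"
  proof (rule solution_drift[where K = "Suc k"])
    show "z (Suc (t + n)) = 2 ^ (e (t + n) - e t) * z (t + n) + z t" for t
      unfolding z_def coord_rec by (simp add: algebra_simps)
    show "\<bar>z k\<bar> \<le> 2 * s k" for k
      using assms by (simp add: z_def followed_by_def)
  qed simp
  moreover have "\<bar>z (k mod n)\<bar> = of_bool (c = k mod n)"
    using n0 mod_less_divisor[OF n0, of k]
    by (auto simp add: z_def coord_initial simp del: mod_less_divisor)
  ultimately show ?thesis by (simp add: z_def)
qed

text \<open>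
  The window ending at \<open>k\<close> contains \<open>k - 1\<close> because \<open>n \<ge> 2\<close>. The single ratio
  \<open>s k / s (k - 1) \<le> (1/2)^(n + 4)\<close> absorbs the factor \<open>2\<^sup>n\<close> coming from \<open>2 * s k\<close> and the
  factor \<open>2\<close> of the product bound.
\<close>
lemma next_denominator_bound:
  assumes "n \<le> k"
  shows "q (Suc k) * (2 * s k) ^ n \<le> 1 / 8"
proof -
  obtain n' where n': "n = Suc (Suc n')"
    using n2 by (metis Suc_1 add_2_eq_Suc le_Suc_ex)
  define t where "t = Suc k - n"
  have k: "k = Suc (t + n')" and tn: "t + n = Suc k"
    using assms by (simp_all add: t_def n')
  have "s k ^ n * 2 ^ (n + 4) = s k ^ n' * (s k * 2 ^ (n + 4)) * s k"
    by (simp add: n')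
  also have "\<dots> \<le> prod s {t..<t + n'} * s (t + n') * s k"
  proof (intro mult_right_mono mult_mono)
    have "s k ^ n' = (\<Prod>i\<in>{t..<t + n'}. s k)" by simp
    also have "\<dots> \<le> prod s {t..<t + n'}"
      by (intro prod_mono) (auto simp: k intro: s_anti)
    finally show "s k ^ n' \<le> prod s {t..<t + n'}" .
    have "s k * 2 ^ (n + 4) \<le> s (t + n') * (1 / 2) ^ (n + 4) * 2 ^ (n + 4)"
      using s_gap[of "t + n'"] assms by (intro mult_right_mono) (auto simp: k)
    then show "s k * 2 ^ (n + 4) \<le> s (t + n')"
      by (simp add: power_one_over)
  qed (auto intro: prod_nonneg)
  also have "\<dots> = prod s {t..<t + n}"
    by (simp add: n' k)
  finally have "q (Suc k) * (s k ^ n * 2 ^ (n + 4)) \<le> q (t + n) * prod s {t..<t + n}"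
    unfolding tn by (intro mult_left_mono) (auto simp: coord_nonneg)
  also have "\<dots> \<le> 2"
    using q_window_product_bounds(2)[of t] by (rule order_trans) simp
  finally show ?thesis by (simp add: power_mult_distrib power_add mult_ac)
qed

text \<open>
  Expand the integer vector \<open>w\<close> in the basis given by the window and let \<open>l0\<close> be the index below
  \<open>n\<close> whose term \<open>\<bar>b l\<bar> * s (t + l)\<close> is largest, equal to \<open>M\<close>. In the coordinate belonging to
  \<open>l0\<close> this term contributes almost \<open>M\<close>, while the other terms of the window contribute little
  because their errors point along other axes. The last coefficient \<open>b n\<close> is controlled by
  comparing denominators. Since \<open>w n < q (t + n)\<close>, not all coefficients below \<open>n\<close> vanish, which
  bounds \<open>M\<close> below by the smallest length in the window.
\<close>
lemma window_lower_bound: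
  assumes x: "followed_by x" and w: "0 < w n" "w n < q (t + n)"
  shows "\<exists>c<n. s (t + n - 1) / 4 \<le> \<bar>of_int (w n) * x c - of_int (w c)\<bar>"
proof -
  have n0: "0 < n" using n2 by simp
  obtain b :: "nat \<Rightarrow> int"
    where b: "\<And>j. j \<le> n \<Longrightarrow> w j = (\<Sum>l\<le>n. b l * coord e n j (t + l))"
    using coord_window_spans[OF n0] by metis
  define \<xi> where "\<xi> c k = real_of_int (q k) * x c - coord e n c k" for c k
  have \<xi>_w: "of_int (w n) * x c - of_int (w c) = (\<Sum>l<n. b l * \<xi> c (t + l)) + b n * \<xi> c (t + n)"
    if "c < n" for c
  proof -
    have "of_int (w n) * x c - of_int (w c) = (\<Sum>l\<le>n. b l * \<xi> c (t + l))"
      using that by (simp add: b \<xi>_def sum_distrib_right sum_distrib_left sum_subtractf algebra_simps)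
    then show ?thesis by (simp add: lessThan_Suc_atMost[symmetric])
  qed
  define S where "S = s (t + n - 1)"
  have S: "0 < S" "l < n \<Longrightarrow> S \<le> s (t + l)" for l
    by (auto simp: S_def intro: s_anti)
  define M where "M = Max ((\<lambda>l. \<bar>b l\<bar> * s (t + l)) ` {..<n})"
  have M_ge: "\<bar>b l\<bar> * s (t + l) \<le> M" if "l < n" for l
    unfolding M_def using that by (intro Max_ge) auto
  have "M \<in> (\<lambda>l. \<bar>b l\<bar> * s (t + l)) ` {..<n}"
    unfolding M_def using n0 by (intro Max_in) auto
  then obtain l0 where l0: "l0 < n" "M = \<bar>b l0\<bar> * s (t + l0)" by auto
  have "\<exists>l<n. b l \<noteq> 0"
  proof (rule ccontr)
    assume "\<not> ?thesis"
    then have "w n = b n * q (t + n)"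
      by (simp add: b lessThan_Suc_atMost[symmetric])
    moreover have "0 < b n"
      using w(1) calculation coord_nonneg[of n "t + n"] by (simp add: zero_less_mult_iff)
    then have "1 * q (t + n) \<le> b n * q (t + n)"
      by (intro mult_right_mono coord_nonneg) simp
    ultimately show False using w(2) by simp
  qed
  then obtain l1 where l1: "l1 < n" "b l1 \<noteq> 0" by blast
  have "1 * S \<le> \<bar>b l1\<bar> * s (t + l1)"
    using l1 S by (intro mult_mono) auto
  then have SM: "S \<le> M" using M_ge[OF l1(1)] by simp
  have b_le: "\<bar>real_of_int (b l)\<bar> \<le> M / S" if "l < n" for l
  proof -
    have "\<bar>b l\<bar> * S \<le> \<bar>b l\<bar> * s (t + l)"
      using S(2)[OF that] by (intro mult_left_mono) auto
    then show ?thesis using M_ge[OF that] S(1) by (simp add: pos_le_divide_eq)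
  qed
  have last: "\<bar>real_of_int (b n)\<bar> \<le> (n + 1) * (M / S)"
  proof -
    let ?Q = "real_of_int (q (t + n))"
    have Q: "0 < ?Q" using w by simp
    have wn: "0 < real_of_int (w n)" using w(1) by simp
    have "real_of_int (b n) * ?Q = real_of_int (w n) - (\<Sum>l<n. real_of_int (b l) * real_of_int (q (t + l)))"
      by (simp add: b lessThan_Suc_atMost[symmetric])
    then have "\<bar>real_of_int (b n)\<bar> * ?Q
        = \<bar>real_of_int (w n) - (\<Sum>l<n. real_of_int (b l) * real_of_int (q (t + l)))\<bar>"
      using Q by (metis abs_mult abs_of_pos)
    also have "\<dots> \<le> w n + (\<Sum>l<n. \<bar>real_of_int (b l) * q (t + l)\<bar>)"
      using wn sum_abs[of "\<lambda>l. real_of_int (b l) * q (t + l)" "{..<n}"] by linarith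
    also have "\<dots> \<le> M / S * ?Q + (\<Sum>l<n. M / S * ?Q)"
    proof (intro add_mono sum_mono)
      have "1 \<le> M / S" using SM S(1) by simp
      then have "1 * ?Q \<le> M / S * ?Q" using Q by (intro mult_right_mono) auto
      then show "real_of_int (w n) \<le> M / S * ?Q" using w(2) by linarith
      fix l assume "l \<in> {..<n}"
      then have "\<bar>real_of_int (b l)\<bar> * \<bar>real_of_int (q (t + l))\<bar> \<le> M / S * ?Q"
        using q_mono[of "t + l" "t + n"] coord_nonneg[of n "t + l"]
        by (intro mult_mono order_trans[OF _ b_le]) (auto intro: order_trans[OF _ b_le])
      then show "\<bar>real_of_int (b l) * q (t + l)\<bar> \<le> M / S * ?Q" by (simp add: abs_mult)
    qed
    also have "\<dots> = ((n + 1) * (M / S)) * ?Q" by (simp add: algebra_simps)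
    finally show ?thesis using Q by (simp only: mult_le_cancel_right_pos)
  qed
  define c where "c = (t + l0) mod n"
  have c: "c < n" using n0 by (simp add: c_def)
  have drift: "\<bar>\<bar>\<xi> c k\<bar> - of_bool (c = k mod n) * s k\<bar> \<le> (1 / 2) ^ n * s k" for k
    unfolding \<xi>_def using x c by (rule followed_drift)
  have main: "M - (1 / 2) ^ n * M \<le> \<bar>b l0 * \<xi> c (t + l0)\<bar>"
  proof -
    have "(1 - (1 / 2) ^ n) * s (t + l0) \<le> \<bar>\<xi> c (t + l0)\<bar>"
      using drift[of "t + l0"] by (simp add: c_def left_diff_distrib abs_le_iff)
    then have "\<bar>real_of_int (b l0)\<bar> * ((1 - (1 / 2) ^ n) * s (t + l0)) \<le> \<bar>b l0 * \<xi> c (t + l0)\<bar>"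
      unfolding abs_mult by (intro mult_left_mono) auto
    then show ?thesis using l0(2) by (simp add: algebra_simps)
  qed
  have others: "\<bar>b l * \<xi> c (t + l)\<bar> \<le> (1 / 2) ^ n * M" if l: "l \<in> {..<n} - {l0}" for l
  proof -
    have "(t + l) mod n \<noteq> (t + l0) mod n"
    proof
      assume "(t + l) mod n = (t + l0) mod n"
      then have "l mod n = l0 mod n" by (auto simp: nat_mod_eq_iff)
      then show False using l l0(1) by simp
    qed
    then have "\<bar>\<xi> c (t + l)\<bar> \<le> (1 / 2) ^ n * s (t + l)"
      using drift[of "t + l"] by (simp add: c_def)
    then have "\<bar>b l * \<xi> c (t + l)\<bar> \<le> \<bar>real_of_int (b l)\<bar> * ((1 / 2) ^ n * s (t + l))"
      unfolding abs_mult by (intro mult_left_mono) auto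
    also have "\<dots> = (1 / 2) ^ n * (\<bar>b l\<bar> * s (t + l))" by simp
    also have "\<dots> \<le> (1 / 2) ^ n * M" using M_ge l by (intro mult_left_mono) auto
    finally show ?thesis .
  qed
  have sum_others: "\<bar>\<Sum>l\<in>{..<n} - {l0}. b l * \<xi> c (t + l)\<bar> \<le> (n - 1) * ((1 / 2) ^ n * M)"
  proof -
    have "\<bar>\<Sum>l\<in>{..<n} - {l0}. b l * \<xi> c (t + l)\<bar> \<le> (\<Sum>l\<in>{..<n} - {l0}. (1 / 2) ^ n * M)"
      by (intro order_trans[OF sum_abs] sum_mono others)
    then show ?thesis using l0 by simp
  qed
  have M0: "0 \<le> M" using SM S by simp
  have pow: "n + 1 \<le> 2 ^ n" by (simp add: Suc_leI)
  have pow2: "2 * n \<le> 2 ^ n"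
  proof -
    obtain m where "n = Suc m" using n0 by (cases n) auto
    moreover have "Suc m \<le> 2 ^ m" by (simp add: Suc_leI)
    ultimately show ?thesis by simp
  qed
  have tail: "\<bar>b n * \<xi> c (t + n)\<bar> \<le> M / 8"
  proof -
    have "s (t + n) \<le> s (t + n - 1) * (1 / 2) ^ (n + 4)"
      using s_gap[of "t + n - 1"] n0 by simp
    then have "2 * s (t + n) \<le> 2 * (S * (1 / 2) ^ (n + 4))" by (simp add: S_def)
    then have "\<bar>\<xi> c (t + n)\<bar> \<le> 2 * (S * (1 / 2) ^ (n + 4))"
      using x c unfolding followed_by_def \<xi>_def by (meson order_trans)
    then have "\<bar>b n * \<xi> c (t + n)\<bar> \<le> (n + 1) * (M / S) * (2 * (S * (1 / 2) ^ (n + 4)))"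
      unfolding abs_mult by (intro mult_mono last) (use M0 S in auto)
    also have "\<dots> = (n + 1) * (M * (1 / 2) ^ n / 8)"
      using S by (simp add: power_add field_simps)
    also have "\<dots> \<le> 2 ^ n * (M * (1 / 2) ^ n / 8)"
      using M0 of_nat_mono[OF pow, where 'a = real] by (intro mult_right_mono) auto
    finally show ?thesis by (simp add: power_one_over)
  qed
  have split: "(\<Sum>l<n. b l * \<xi> c (t + l))
      = b l0 * \<xi> c (t + l0) + (\<Sum>l\<in>{..<n} - {l0}. b l * \<xi> c (t + l))"
    using l0 by (subst sum.remove[of _ l0]) auto
  have "real n * ((1 / 2) ^ n * M) \<le> M / 2"
  proof -
    have "(2 * real n) * ((1 / 2) ^ n * M) \<le> 2 ^ n * ((1 / 2) ^ n * M)"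
      using M0 of_nat_mono[OF pow2, where 'a = real] by (intro mult_right_mono) auto
    then show ?thesis by (simp add: power_one_over mult_ac)
  qed
  moreover have "(n - 1) * ((1 / 2) ^ n * M) = real n * ((1 / 2) ^ n * M) - (1 / 2) ^ n * M"
    using n0 by (simp add: of_nat_diff algebra_simps)
  ultimately have "M / 4 \<le> \<bar>of_int (w n) * x c - of_int (w c)\<bar>"
    using main sum_others tail M0 unfolding \<xi>_w[OF c] split by linarith
  then have "S / 4 \<le> \<bar>of_int (w n) * x c - of_int (w c)\<bar>" using SM by linarith
  then show ?thesis using c by (auto simp: S_def)
qed

end

section \<open>The Diophantine classes\<close>

lemma less_powr_iff_power:
  fixes y \<epsilon> N :: real
  assumes "0 < n" "0 \<le> y" "0 < \<epsilon>" "0 < N"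
  shows "y < \<epsilon> * N powr (- 1 / real n) \<longleftrightarrow> y ^ n * N < \<epsilon> ^ n"
proof -
  let ?w = "\<epsilon> * N powr (- 1 / real n)"
  have "(N powr (- 1 / real n)) ^ n = N powr (- 1)"
    using assms by (simp add: powr_realpow[symmetric] powr_powr)
  then have w: "?w ^ n = \<epsilon> ^ n / N"
    using assms by (simp only: power_mult_distrib) (simp add: powr_minus_divide)
  have "?w \<le> y \<longleftrightarrow> ?w ^ n \<le> y ^ n"
    using assms by (intro power_mono_iff[symmetric]) auto
  then have "y < ?w \<longleftrightarrow> y ^ n < ?w ^ n"
    by (simp only: not_le[symmetric])
  also have "\<dots> \<longleftrightarrow> y ^ n * N < \<epsilon> ^ n"
    unfolding w using assms by (intro pos_less_divide_eq)
  finally show ?thesis .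
qed

lemma int_dist_vec_le_iff: "int_dist_vec v \<le> B \<longleftrightarrow> (\<forall>i. int_dist (v $ i) \<le> B)"
  by (auto simp: int_dist_vec_def)

lemma int_dist_le_vec: "int_dist (v $ i) \<le> int_dist_vec v"
  using int_dist_vec_le_iff by blast

text \<open>
  The recurrence indexes coordinates by \<open>{..<n}\<close>; the bijection \<open>idx\<close> transports them to the
  index type of the vectors.
\<close>
locale followed_vector = exponents n e for n e +
  fixes x :: "nat \<Rightarrow> real" and idx :: "'d :: finite \<Rightarrow> nat"
  assumes follow: "followed_by x"
    and idx: "bij_betw idx UNIV {..<n}"
begin

definition v :: "real ^ 'd" where "v = (\<chi> i. x (idx i))"

lemma card_index: "CARD('d) = n"
  using bij_betw_same_card[OF idx] by simp

lemma int_dist_vec_q: "int_dist_vec (of_int (q k) *\<^sub>R v) \<le> 2 * s k"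
  unfolding int_dist_vec_le_iff
proof
  fix i
  have "idx i < n" using idx by (auto simp: bij_betw_def)
  then have "\<bar>real_of_int (q k) * x (idx i) - coord e n (idx i) k\<bar> \<le> 2 * s k"
    using follow by (simp add: followed_by_def)
  then show "int_dist ((of_int (q k) *\<^sub>R v) $ i) \<le> 2 * s k"
    using int_dist_is_min(2) by (auto simp: v_def intro: order_trans)
qed

lemma q_approximates:
  fixes \<epsilon> N :: real
  assumes "n \<le> k" "0 < \<epsilon>" "0 < N" "N * (1 / 8) < \<epsilon> ^ n * q (Suc k)"
  shows "int_dist_vec (of_int (q k) *\<^sub>R v) < \<epsilon> * N powr (- 1 / real n)"
proof -
  have n0: "0 < n" using n2 by simp
  obtain t where "Suc k = t + n" using \<open>n \<le> k\<close> by (metis add.commute le_Suc_ex le_SucI)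
  then have q: "0 < q (Suc k)" using q_lower[of t] by simp
  have "q (Suc k) * ((2 * s k) ^ n * N) = N * (q (Suc k) * (2 * s k) ^ n)" by simp
  also have "\<dots> \<le> N * (1 / 8)"
    using next_denominator_bound[OF \<open>n \<le> k\<close>] assms by (intro mult_left_mono) auto
  also have "\<dots> < q (Suc k) * \<epsilon> ^ n" using assms(4) by (simp add: mult.commute)
  finally have "(2 * s k) ^ n * N < \<epsilon> ^ n" using q by simp
  then have "2 * s k < \<epsilon> * N powr (- 1 / real n)"
    using n0 assms by (subst less_powr_iff_power) auto
  then show ?thesis using int_dist_vec_q[of k] by simp
qed

text \<open>Every \<open>N\<close> lies in some interval \<open>[q k, q (k + 1))\<close>, and there \<open>q k\<close> is a witness.\<close>
lemma v_in_DI: "v \<in> DI"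
proof -
  \<comment> \<open>The power \<open>\<epsilon> ^ n\<close> may be any number in \<open>[1/8, 1)\<close>.\<close>
  define \<epsilon> :: real where "\<epsilon> = root n (1 / 2)"
  have n0: "0 < n" using n2 by simp
  have \<epsilon>: "\<epsilon> \<in> {0<..<1}" "\<epsilon> ^ n = 1 / 2"
    using n0 by (auto simp: \<epsilon>_def)
  have "\<exists>r. dirichlet_cond v \<epsilon> N r" if "N > 0" for N
  proof -
    define j where "j = (LEAST j. int N < q (j + n))"
    have "int N < q (N + n)" using q_lower[of N] by simp
    then have j: "int N < q (j + n)" unfolding j_def by (rule LeastI)
    have "j \<noteq> 0" using j that by (intro notI) (simp add: coord_initial)
    then obtain i where i: "j = Suc i" by (cases j) auto
    then have le: "q (i + n) \<le> int N"
      using not_less_Least[of i "\<lambda>j. int N < q (j + n)"] by (simp add: j_def)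
    have "real N < q (Suc (i + n))" using j i by (simp add: of_int_less_iff[symmetric, where 'a = real] del: of_int_less_iff)
    then have "real N * (1 / 8) < \<epsilon> ^ n * q (Suc (i + n))"
      using that unfolding \<epsilon>(2) by linarith
    then have "int_dist_vec (of_int (q (i + n)) *\<^sub>R v) < \<epsilon> * real N powr (- 1 / real n)"
      using \<epsilon>(1) that by (intro q_approximates) auto
    then show ?thesis
      using le q_lower[of i] by (auto simp: dirichlet_cond_def card_index)
  qed
  then show ?thesis unfolding DI_def using \<epsilon>(1) by blast
qed

text \<open>
  The denominator \<open>q k\<close> approximates at the quality expected from the next denominator, which is
  larger by an unbounded factor.
\<close>
lemma v_not_in_Bad: "v \<notin> Bad"
proof
  assume "v \<in> Bad"
  then obtain \<epsilon> where \<epsilon>: "0 < \<epsilon>"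
    and bad: "\<And>r :: nat. 1 \<le> r \<Longrightarrow> \<epsilon> * real r powr (- 1 / real n) < int_dist_vec (real r *\<^sub>R v)"
    unfolding Bad_def card_index by auto
  obtain t where t: "(1 / 2) ^ t < \<epsilon> ^ n"
    using real_arch_pow_inv[of "\<epsilon> ^ n" "1 / 2"] \<epsilon> by auto
  define r where "r = nat (q (t + n))"
  have q0: "0 < q (t + n)" using q_lower[of t] by simp
  then have r: "int r = q (t + n)" "real r = q (t + n)" "1 \<le> r"
    by (simp_all add: r_def)
  have "2 ^ t * q (t + n) \<le> 2 ^ (t + 2 * n + 1) * q (t + n)"
    using q0 by (intro mult_right_mono power_increasing) auto
  also have "\<dots> \<le> q (Suc (t + n))" by (rule q_growth)
  finally have "real_of_int (2 ^ t * q (t + n)) \<le> q (Suc (t + n))" by (simp only: of_int_le_iff)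
  then have "(1 / 2) ^ t * (2 ^ t * real r) \<le> (1 / 2) ^ t * real_of_int (q (Suc (t + n)))"
    by (intro mult_left_mono) (simp_all add: r)
  also have "\<dots> < \<epsilon> ^ n * q (Suc (t + n))"
    using t q0 q_Suc[of "t + n"] by (intro mult_strict_right_mono) auto
  finally have "real r < \<epsilon> ^ n * q (Suc (t + n))" by (simp add: power_one_over)
  then have "real r * (1 / 8) < \<epsilon> ^ n * q (Suc (t + n))" using r(3) by linarith
  then have "int_dist_vec (of_int (q (t + n)) *\<^sub>R v) < \<epsilon> * real r powr (- 1 / real n)"
    using \<epsilon> r(3) by (intro q_approximates) auto
  then show False using bad[OF r(3)] by (simp add: r(2))
qed

text \<open>
  Take \<open>N = q (t + n) - 1\<close>, just before a new denominator becomes available. If all lengths of the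
  window are within a factor \<open>2 ^ C\<close> of the smallest one, \<open>S\<close>, then \<open>q (t + n)\<close> is at least
  \<open>(2 ^ C * S) ^ (- n)\<close>, so the lower bound \<open>S / 4\<close> is a fixed multiple of \<open>N powr (- 1 / n)\<close>.
\<close>
lemma v_not_in_Sing:
  assumes cluster: "\<And>T. \<exists>t\<ge>T. e (t + n - 1) \<le> e t + C"
  shows "v \<notin> Sing"
proof
  assume sing: "v \<in> Sing"
  define \<epsilon> :: real where "\<epsilon> = (1 / 2) ^ (C + 3)"
  have n0: "0 < n" using n2 by simp
  have \<epsilon>: "\<epsilon> \<in> {0<..<1}"
    unfolding \<epsilon>_def by (simp add: power_one_over one_less_power divide_less_eq)
  then obtain N\<^sub>0 where N\<^sub>0: "\<And>N. N > N\<^sub>0 \<Longrightarrow> \<exists>r. dirichlet_cond v \<epsilon> N r"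
    using sing unfolding Sing_def by blast
  obtain t where t: "t \<ge> N\<^sub>0 + 2" "e (t + n - 1) \<le> e t + C" using cluster by blast
  define S where "S = s (t + n - 1)"
  have S0: "0 < S" by (simp add: S_def)
  define N where "N = nat (q (t + n) - 1)"
  have N: "int N = q (t + n) - 1" "N > N\<^sub>0" using q_lower[of t] t(1) by (simp_all add: N_def)
  obtain r where r: "dirichlet_cond v \<epsilon> N r" using N\<^sub>0[OF N(2)] by blast
  \<comment> \<open>The supposed denominator together with the nearest integers to the multiplied coordinates.\<close>
  define w where "w j = (if j = n then r else round (of_int r * x j))" for j
  have "\<exists>c<n. s (t + n - 1) / 4 \<le> \<bar>of_int (w n) * x c - of_int (w c)\<bar>"
    using r N by (intro window_lower_bound follow) (auto simp: w_def dirichlet_cond_def)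
  then obtain c where c: "c < n" "S / 4 \<le> \<bar>of_int r * x c - of_int (round (of_int r * x c))\<bar>"
    by (auto simp: w_def S_def)
  then obtain i where i: "c = idx i" using idx by (auto simp: bij_betw_def)
  have "S / 4 \<le> int_dist ((of_int r *\<^sub>R v) $ i)"
    using c by (simp add: i v_def int_dist_eq_round)
  also have "\<dots> \<le> int_dist_vec (of_int r *\<^sub>R v)" by (rule int_dist_le_vec)
  also have "\<dots> < \<epsilon> * real N powr (- 1 / real n)"
    using r by (simp add: dirichlet_cond_def card_index)
  finally have "S / 4 < \<epsilon> * real N powr (- 1 / real n)" .
  then have small: "(S / 4) ^ n * N < \<epsilon> ^ n"
    using n0 S0 \<epsilon> N by (subst (asm) less_powr_iff_power) auto
  have "s (t + i) \<le> 2 ^ C * S" if "i < n" for i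
  proof -
    have "(1 / 2 :: real) ^ (e t + C) \<le> (1 / 2) ^ e (t + n - 1)"
      using t(2) by (intro power_decreasing) auto
    then have "s t \<le> 2 ^ C * S"
      by (simp add: S_def scale_def power_add power_one_over field_simps)
    then show ?thesis using s_anti[of t "t + i"] by simp
  qed
  then have "prod s {t..<t + n} \<le> (\<Prod>l\<in>{t..<t + n}. 2 ^ C * S)"
    by (intro prod_mono) (auto simp: le_iff_add)
  then have "prod s {t..<t + n} \<le> (2 ^ C * S) ^ n" by simp
  then have "q (t + n) * prod s {t..<t + n} \<le> q (t + n) * (2 ^ C * S) ^ n"
    by (intro mult_left_mono) (auto simp: coord_nonneg)
  then have "1 \<le> q (t + n) * (2 ^ C * S) ^ n"
    using q_window_product_bounds(1)[of t] by linarith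
  also have "\<dots> \<le> (2 * real N) * (2 ^ C * S) ^ n"
  proof (intro mult_right_mono)
    have "q (t + n) \<le> 2 * int N" using N by simp
    then show "real_of_int (q (t + n)) \<le> 2 * real N"
      by (metis of_int_le_iff of_int_mult of_int_numeral of_int_of_nat_eq)
  qed (use S0 in auto)
  finally have ge: "1 \<le> 2 * real N * (2 ^ C * S) ^ n" .
  have "\<epsilon> ^ n * (2 * (2 ^ n)) \<le> \<epsilon> ^ n * (2 * 2 ^ n) * (2 * real N * (2 ^ C * S) ^ n) / 1"
    using mult_left_mono[OF ge, of "\<epsilon> ^ n * (2 * 2 ^ n)"] \<epsilon> by simp
  also have "\<dots> = 4 * (\<epsilon> * 2 ^ Suc C * S) ^ n * real N"
    by (simp add: power_mult_distrib)
  also have "\<epsilon> * 2 ^ Suc C * S = S / 4"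
    by (simp add: \<epsilon>_def power_add power_one_over)
  also have "4 * (S / 4) ^ n * real N < 4 * \<epsilon> ^ n" using small by simp
  finally have "2 * 2 ^ n < (4 :: real)" using \<epsilon> by simp
  moreover have "2 ^ 1 \<le> (2 :: real) ^ n" using n0 by (intro power_increasing) auto
  ultimately show False by simp
qed

end

section \<open>Distinct exponents give distinct points\<close>

text \<open>
  At the first index where two exponent sequences differ, the integer vectors still agree, so a
  common point would have the same error there; but its length is within a quarter of both
  prescribed lengths, which differ at least by a factor of two.
\<close>
lemma followed_by_inj:
  assumes "exponents n e" "exponents n e'"
    and "exponents.followed_by n e x" "exponents.followed_by n e' x'"
    and same: "\<And>c. c < n \<Longrightarrow> x c = x' c"
  shows "e = e'"
proof (rule ccontr)
  assume "e \<noteq> e'"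
  interpret E: exponents n e by fact
  interpret E': exponents n e' by fact
  define k where "k = (LEAST k. e k \<noteq> e' k)"
  have k: "e k \<noteq> e' k"
    using LeastI_ex[of "\<lambda>k. e k \<noteq> e' k"] \<open>e \<noteq> e'\<close> by (simp add: k_def fun_eq_iff)
  have below: "e i = e' i" if "i < k" for i
    using not_less_Least[of i "\<lambda>k. e k \<noteq> e' k"] that by (auto simp: k_def)
  have coord_eq: "coord e n j k = coord e' n j k" for j
    by (rule coord_cong) (rule below)
  define c where "c = k mod n"
  have c: "c < n" using E.n2 by (simp add: c_def)
  define z where "z = \<bar>real_of_int (coord e n n k) * x c - coord e n c k\<bar>"
  have "(1 / 2 :: real) ^ n \<le> (1 / 2) ^ 2" using E.n2 by (intro power_decreasing) auto
  then have quarter: "(1 / 2) ^ n * E.s k \<le> 1 / 4 * E.s k" "(1 / 2) ^ n * E'.s k \<le> 1 / 4 * E'.s k"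
    by (auto intro!: mult_right_mono simp: power2_eq_square)
  have "\<bar>z - E.s k\<bar> \<le> (1 / 2) ^ n * E.s k"
    using E.followed_drift[OF assms(3) c, of k] by (simp add: z_def c_def)
  moreover have "\<bar>z - E'.s k\<bar> \<le> (1 / 2) ^ n * E'.s k"
    using E'.followed_drift[OF assms(4) c, of k] same[OF c]
    by (simp add: z_def c_def coord_eq)
  moreover have "scale f k \<le> scale g k / 2" if "g k < f k" for f g
    using power_decreasing[of "Suc (g k)" "f k" "1 / 2 :: real"] that by (simp add: scale_def)
  then have "E.s k \<le> E'.s k / 2 \<or> E'.s k \<le> E.s k / 2"
    using k by (metis nat_neq_iff)
  ultimately show False using quarter E.s_pos(1)[of k] E'.s_pos(1)[of k] by linarith
qed

text \<open>
  The linear term provides the gap between consecutive exponents. The quadratic term, constant on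
  blocks of length \<open>n\<close>, provides the growth of the multipliers without disturbing the bounded
  spread within a block. The last term encodes membership in \<open>A\<close>, one bit per block from the
  block with number \<open>1\<close> on.
\<close>
definition set_exponent :: "nat \<Rightarrow> nat set \<Rightarrow> nat \<Rightarrow> nat" where
  "set_exponent n A k =
     (if k < n then 0 else (n + 5) * k + n * (k div n)\<^sup>2 + of_bool (k div n - 1 \<in> A))"

lemma exponents_set_exponent:
  assumes "2 \<le> n"
  shows "exponents n (set_exponent n A)"
proof
  show "2 \<le> n" by fact
  show "set_exponent n A k = 0" if "k < n" for k
    using that by (simp add: set_exponent_def)
  show "set_exponent n A k + n + 4 \<le> set_exponent n A (Suc k)" if "n \<le> Suc k" for k
  proof (cases "k < n")
    case True
    then have "Suc k = n" using that by simp
    moreover have "2 * 2 \<le> (n + 5) * n" using assms by (intro mult_mono) auto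
    ultimately show ?thesis using assms by (simp add: set_exponent_def)
  next
    case False
    consider "Suc k div n = k div n" | "Suc k div n = Suc (k div n)"
      by (metis div_Suc)
    then show ?thesis
    proof cases
      case 1
      then show ?thesis using False by (simp add: set_exponent_def)
    next
      case 2
      then show ?thesis using False by (simp add: set_exponent_def power2_eq_square algebra_simps)
    qed
  qed
  show "set_exponent n A t + t + 2 * n + 1 \<le> set_exponent n A (t + n)" for t
  proof -
    define m where "m = t div n"
    have m: "(t + n) div n = Suc m" using assms by (simp add: m_def)
    have t: "t \<le> n * m + n"
    proof -
      have "t mod n < n" using assms by simp
      then show ?thesis using mult_div_mod_eq[of n t] unfolding m_def by linarith
    qed
    have n: "2 * n \<le> n * n" using assms by (intro mult_right_mono) auto
    show ?thesis
    proof (cases "t < n")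
      case True
      have "t * n \<ge> t * 1" using assms by (intro mult_left_mono) auto
      then show ?thesis using True n assms
        by (simp add: set_exponent_def m algebra_simps power2_eq_square)
    next
      case False
      then show ?thesis using t n assms
        by (simp add: set_exponent_def m m_def[symmetric] algebra_simps power2_eq_square)
    qed
  qed
qed

lemma set_exponent_inj:
  assumes "0 < n" "set_exponent n A = set_exponent n B"
  shows "A = B"
proof (rule set_eqI)
  fix m
  have "set_exponent n A (n * Suc m) = set_exponent n B (n * Suc m)" using assms by simp
  then show "m \<in> A \<longleftrightarrow> m \<in> B"
    using assms(1) by (simp add: set_exponent_def of_bool_eq_iff del: mult_Suc_right split: if_splits)
qed

text \<open>A window that coincides with a block only sees the linear term vary.\<close>
lemma set_exponent_cluster:
  assumes "0 < n"
  shows "\<exists>t\<ge>T. set_exponent n A (t + n - 1) \<le> set_exponent n A t + (n + 5) * n"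
proof (intro exI conjI)
  let ?t = "n * Suc T"
  have "1 * Suc T \<le> ?t" using assms by (intro mult_right_mono) auto
  then show "T \<le> ?t" by simp
  have "(?t + n - 1) div n = Suc T"
    using assms by (intro div_nat_eqI) (auto simp: algebra_simps)
  moreover have "?t div n = Suc T" using assms by simp
  moreover have "(n + 5) * (?t + n - 1) \<le> (n + 5) * (?t + n)" by (intro mult_left_mono) auto
  ultimately show "set_exponent n A (?t + n - 1) \<le> set_exponent n A ?t + (n + 5) * n"
    by (simp add: set_exponent_def distrib_left del: mult_Suc_right)
qed

section \<open>Cardinality\<close>

text \<open>A vector is determined by the rational lower cuts of its coordinates.\<close>
lemma lepoll_real_vec: "(UNIV :: (real ^ 'n :: finite) set) \<lesssim> (UNIV :: real set)"
proof -
  define code :: "real ^ 'n \<Rightarrow> nat set" where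
    "code v = to_nat ` {(i, r :: rat). of_rat r < v $ i}" for v
  have "inj code"
  proof
    fix v w assume "code v = code w"
    then have eq: "{(i, r :: rat). of_rat r < v $ i} = {(i, r :: rat). of_rat r < w $ i}"
      unfolding code_def by (metis inj_image_eq_iff inj_to_nat)
    have iff: "of_rat r < v $ i \<longleftrightarrow> of_rat r < w $ i" for i r
      using eq by (auto simp: set_eq_iff)
    show "v = w"
    proof (rule vec_eq_iff[THEN iffD2], rule allI)
      fix i
      show "v $ i = w $ i"
      proof (rule linorder_cases)
        assume "v $ i < w $ i"
        then obtain r where "v $ i < of_rat r" "of_rat r < w $ i" using of_rat_dense by blast
        then show ?thesis using iff[of r i] by simp
      next
        assume "w $ i < v $ i"
        then obtain r where "w $ i < of_rat r" "of_rat r < v $ i" using of_rat_dense by blast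
        then show ?thesis using iff[of r i] by simp
      qed
    qed
  qed
  then have "(UNIV :: (real ^ 'n) set) \<lesssim> (UNIV :: nat set set)"
    unfolding lepoll_def by blast
  then show ?thesis using nat_sets_eqpoll_reals by (rule lepoll_trans2)
qed

theorem theorem1p2:
  assumes "CARD('n::finite) \<ge> 2"
  shows "(FS :: (real ^ 'n) set) \<approx> (UNIV :: real set)"
proof (rule lepoll_antisym)
  show "(FS :: (real ^ 'n) set) \<lesssim> (UNIV :: real set)"
    using lepoll_real_vec by (meson lepoll_trans subset_imp_lepoll subset_UNIV)
next
  define n where "n = CARD('n)"
  have n2: "2 \<le> n" using assms by (simp add: n_def)
  obtain idx :: "'n \<Rightarrow> nat" where idx: "bij_betw idx UNIV {..<n}"
    using ex_bij_betw_finite_nat[OF finite[of "UNIV :: 'n set"]]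
    unfolding n_def atLeast0LessThan by blast
  define X where "X A = (SOME x. exponents.followed_by n (set_exponent n A) x)" for A
  have X: "exponents.followed_by n (set_exponent n A) (X A)" for A
    unfolding X_def using exponents.followed_point_exists[OF exponents_set_exponent[OF n2]]
    by (rule someI_ex)
  define V :: "nat set \<Rightarrow> real ^ 'n" where "V A = (\<chi> i. X A (idx i))" for A
  have "V A \<in> FS" for A
  proof -
    interpret followed_vector n "set_exponent n A" "X A" idx
      by (intro followed_vector.intro exponents_set_exponent followed_vector_axioms.intro n2 X idx)
    have "V A = v" by (simp add: V_def v_def)
    moreover have "v \<notin> Sing"
    proof (rule v_not_in_Sing)
      show "\<exists>t\<ge>T. set_exponent n A (t + n - 1) \<le> set_exponent n A t + (n + 5) * n" for T
        using n2 by (intro set_exponent_cluster) simp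
    qed
    ultimately show ?thesis using v_in_DI v_not_in_Bad by (simp add: FS_def)
  qed
  moreover have "inj V"
  proof
    fix A B assume "V A = V B"
    then have "X A (idx i) = X B (idx i)" for i by (simp add: V_def vec_eq_iff)
    then have "X A c = X B c" if "c < n" for c
      using that idx by (metis bij_betw_imp_surj_on imageE lessThan_iff)
    then have "set_exponent n A = set_exponent n B"
      using followed_by_inj[OF exponents_set_exponent[OF n2] exponents_set_exponent[OF n2] X X]
      by blast
    then show "A = B" using n2 by (intro set_exponent_inj[of n]) auto
  qed
  ultimately have "(UNIV :: nat set set) \<lesssim> (FS :: (real ^ 'n) set)"
    unfolding lepoll_def by blast
  then show "(UNIV :: real set) \<lesssim> (FS :: (real ^ 'n) set)"
    using nat_sets_eqpoll_reals by (meson eqpoll_sym lepoll_trans1)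
qed

end
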